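(* Let $\{b_i\}_{i\in\mathbb N}\subseteq\mathbb N$ be such that $0\le b_{i+1}-b_i\le 2$ for all $i\in\mathbb N$. Then: (i) $\mathcal S_1(b_1)=\{(x_1)\mid x_1\in\{2,\ldots,b_1\}\}$. (ii) For every positive integer $k$, $\mathcal S_{k+1}(b_{k+1})$ is the set of all sequences $(x_1,\ldots,x_{k+1})$ such that $(x_1,\ldots,x_k)\in\mathcal S_k(b_k)$ and $x_{k+1}\in \mathrm S(x_1,\ldots,x_k)\cap\left(0,\,b_{k+1}-\sum_{i=1}^k x_i\right]$.
   Context: $\mathbb N$ denotes the set of nonnegative integers. An Arf sequence is a finite sequence of integers $(x_1,\ldots,x_n)$, $n\ge 1$, such that $x_n\ge\cdots\ge x_1\ge 2$ and, for every $i\in\{1,\ldots,n-1\}$, $x_{i+1}\in\{x_i,\,x_i+x_{i-1},\ldots,x_i+\cdots+x_1,\to\}$, where the arrow $\to$ after the last listed integer means that all integers larger than it belong to the set. For an Arf sequence $(x_1,\ldots,x_n)$, put $\mathrm S(x_1,\ldots,x_n)=\{0,x_n,x_n+x_{n-1},\ldots,x_n+\cdots+x_1,\to\}$. For a positive integer $k$, $\mathcal S_k$ is the set of all Arf sequences of length $k$, and for an integer $n$, $\mathcal S_k(n)=\{(x_1,\ldots,x_k)\in\mathcal S_k\mid x_1+\cdots+x_k\le n\}$. The interval $(x,y]$ is the set of real numbers $r$ with $x<r\le y$ (empty if $y\le x$), and $\{2,\ldots,b\}$ is empty if $b<2$. *)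

theory Defs
  imports Main
begin

text \<open>
  Sequences \<open>(x\<^sub>1, \<dots>, x\<^sub>n)\<close> are integer lists; \<open>x\<^sub>i\<close> is \<open>entry xs i\<close>, with indices starting at 1.
\<close>

definition entry :: "int list \<Rightarrow> nat \<Rightarrow> int" where
  "entry xs i = xs ! (i - 1)"

text \<open>
  The set \<open>{x\<^sub>i, x\<^sub>i + x\<^sub>i\<^sub>-\<^sub>1, \<dots>, x\<^sub>i + \<dots> + x\<^sub>1, \<rightarrow>}\<close>, where the arrow stands for all integers
  larger than the last listed one.
\<close>

definition backward_sums :: "int list \<Rightarrow> nat \<Rightarrow> int set" where
  "backward_sums xs i =
     {(\<Sum>l=j..i. entry xs l) | j. 1 \<le> j \<and> j \<le> i} \<union> {(\<Sum>l=1..i. entry xs l) <..}"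

definition Arf_sequence :: "int list \<Rightarrow> bool" where
  "Arf_sequence xs \<longleftrightarrow>
     length xs \<ge> 1 \<and> sorted xs \<and> entry xs 1 \<ge> 2 \<and>
     (\<forall>i. 1 \<le> i \<and> i \<le> length xs - 1 \<longrightarrow> entry xs (i + 1) \<in> backward_sums xs i)"

definition Arf_S :: "int list \<Rightarrow> int set" where
  "Arf_S xs = {0} \<union> backward_sums xs (length xs)"

definition Arf_sequences :: "nat \<Rightarrow> int list set" where
  "Arf_sequences k = {xs. Arf_sequence xs \<and> length xs = k}"

definition Arf_sequences_le :: "nat \<Rightarrow> int \<Rightarrow> int list set" where
  "Arf_sequences_le k n = {xs \<in> Arf_sequences k. (\<Sum>i=1..k. entry xs i) \<le> n}"

end

theory Submission
  imports Defs
begin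

text \<open>
  Appending \<open>x\<close> to an Arf sequence \<open>xs\<close> gives an Arf sequence if and only if \<open>x\<close> is a positive
  element of \<open>Arf_S xs\<close>: every such element is at least the last entry of \<open>xs\<close>, so monotonicity is
  automatic. Since \<open>x \<ge> 2\<close> and \<open>b\<close> grows by at most \<open>2\<close> in each step, the bound on the sum of the
  longer sequence implies the bound on the sum of \<open>xs\<close>.
\<close>

lemma entry_append [simp]: "1 \<le> i \<Longrightarrow> i \<le> length xs \<Longrightarrow> entry (xs @ ys) i = entry xs i"
  by (auto simp: entry_def nth_append)

lemma entry_append_last [simp]: "entry (xs @ [x]) (Suc (length xs)) = x"
  by (simp add: entry_def)

lemma sum_entry_append:
  assumes "1 \<le> j" and "i \<le> length xs"
  shows "(\<Sum>l=j..i. entry (xs @ ys) l) = (\<Sum>l=j..i. entry xs l)"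
  using assms by (intro sum.cong) auto

text \<open>Only the first \<open>i\<close> entries enter \<open>backward_sums xs i\<close>, so the
  conditions imposed on a prefix are unaffected by what follows it.\<close>

lemma backward_sums_append:
  "i \<le> length xs \<Longrightarrow> backward_sums (xs @ ys) i = backward_sums xs i"
  unfolding backward_sums_def using sum_entry_append[of _ i xs ys]
  by (intro arg_cong2[where f = "(\<union>)"] Collect_cong ex_cong1) auto

lemma Arf_sequence_singleton: "Arf_sequence [x] \<longleftrightarrow> x \<ge> 2"
  by (auto simp: Arf_sequence_def entry_def)

text \<open>Sortedness passes the bound on the first entry to all later ones.\<close>

lemma Arf_sequence_entry_ge_2:
  assumes "Arf_sequence xs" and "1 \<le> i" and "i \<le> length xs"
  shows "entry xs i \<ge> 2"
proof -
  have "xs ! 0 \<le> xs ! (i - 1)"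
    using assms by (intro sorted_nth_mono) (auto simp: Arf_sequence_def)
  then show ?thesis
    using assms by (simp add: Arf_sequence_def entry_def)
qed

text \<open>Each listed sum has the last entry as a summand and its other summands are positive; the
  arrow part lies above the longest of these sums.\<close>

lemma backward_sums_ge_last:
  assumes "Arf_sequence xs" and "x \<in> backward_sums xs (length xs)"
  shows "entry xs (length xs) \<le> x"
proof -
  have ge: "entry xs (length xs) \<le> (\<Sum>l=j..length xs. entry xs l)"
    if "1 \<le> j" "j \<le> length xs" for j
    using that Arf_sequence_entry_ge_2[OF assms(1)]
    by (intro member_le_sum) (force intro: order_trans[of 0 2])+
  have "1 \<le> length xs"
    using assms(1) by (simp add: Arf_sequence_def)
  then have "entry xs (length xs) \<le> (\<Sum>l=1..length xs. entry xs l)"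
    by (intro ge) auto
  with ge assms(2) show ?thesis
    by (auto simp: backward_sums_def)
qed

text \<open>The conditions at indices below \<open>length xs\<close> involve \<open>xs\<close>
  alone, and the one at \<open>length xs\<close> is exactly the membership of \<open>x\<close>. For
  \<open>xs = []\<close> there is no such index, and the only demand on \<open>x\<close> would be
  \<open>x \<ge> 2\<close>.\<close>

lemma Arf_sequence_snoc:
  assumes "xs \<noteq> []"
  shows "Arf_sequence (xs @ [x]) \<longleftrightarrow> Arf_sequence xs \<and> x \<in> backward_sums xs (length xs)"
proof
  assume A: "Arf_sequence (xs @ [x])"
  then have step: "entry (xs @ [x]) (i + 1) \<in> backward_sums (xs @ [x]) i"
    if "1 \<le> i" "i \<le> length xs" for i
    using that by (simp add: Arf_sequence_def)
  have len: "1 \<le> length xs"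
    using assms by (cases xs) auto
  \<comment> \<open>Here \<open>i + 1 \<le> length xs\<close>, so the entry in question still lies
    in \<open>xs\<close>; at \<open>i = length xs\<close> it is \<open>x\<close>.\<close>
  have "entry xs (i + 1) \<in> backward_sums xs i" if "1 \<le> i" "i \<le> length xs - 1" for i
    using step[of i] that len by (simp add: backward_sums_append)
  moreover have "x \<in> backward_sums xs (length xs)"
    using step[of "length xs"] len by (simp add: backward_sums_append)
  ultimately show "Arf_sequence xs \<and> x \<in> backward_sums xs (length xs)"
    using A len by (simp add: Arf_sequence_def sorted_append)
next
  assume A: "Arf_sequence xs \<and> x \<in> backward_sums xs (length xs)"
  have len: "1 \<le> length xs"
    using assms by (cases xs) auto
  \<comment> \<open>Sortedness of the longer list: every entry is at most the last entry of
    \<open>xs\<close>, which is at most \<open>x\<close>.\<close>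
  have "y \<le> x" if "y \<in> set xs" for y
  proof -
    from that obtain i where i: "i < length xs" "y = xs ! i"
      by (metis in_set_conv_nth)
    then have "y \<le> entry xs (length xs)"
      unfolding entry_def i(2) using A by (intro sorted_nth_mono) (auto simp: Arf_sequence_def)
    then show ?thesis
      using backward_sums_ge_last A by fastforce
  qed
  moreover have "entry (xs @ [x]) (i + 1) \<in> backward_sums (xs @ [x]) i"
    if "1 \<le> i" "i \<le> length xs" for i
    using that A by (cases "i = length xs") (simp_all add: backward_sums_append Arf_sequence_def)
  ultimately show "Arf_sequence (xs @ [x])"
    using A len by (simp add: Arf_sequence_def sorted_append)
qed

text \<open>All backward sums are at least the last entry, hence at least 2, so requiring positivity
  removes only the extra element 0.\<close>

lemma Arf_S_pos_iff:
  assumes "Arf_sequence xs"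
  shows "x \<in> Arf_S xs \<and> 0 < x \<longleftrightarrow> x \<in> backward_sums xs (length xs)"
proof -
  have "2 \<le> x" if "x \<in> backward_sums xs (length xs)"
    using backward_sums_ge_last[OF assms that] Arf_sequence_entry_ge_2[OF assms, of "length xs"] assms
    by (simp add: Arf_sequence_def)
  then show ?thesis
    by (auto simp: Arf_S_def)
qed

lemma Arf_sequences_le_1: "Arf_sequences_le 1 n = {[x] | x. x \<in> {2..n}}"
  by (auto simp: Arf_sequences_le_def Arf_sequences_def length_Suc_conv Arf_sequence_singleton
      entry_def)

lemma Arf_sequences_le_Suc:
  assumes "k \<ge> 1" and "m \<le> n + 2"
  shows "Arf_sequences_le (k + 1) m =
    {xs @ [x] | xs x. xs \<in> Arf_sequences_le k n \<and>
      x \<in> Arf_S xs \<inter> {0 <.. m - (\<Sum>i=1..k. entry xs i)}}"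
    (is "?L = ?R")
proof -
  have snoc: "xs @ [x] \<in> ?L \<longleftrightarrow>
      xs \<in> Arf_sequences_le k n \<and> x \<in> Arf_S xs \<inter> {0 <.. m - (\<Sum>i=1..k. entry xs i)}"
    if len: "length xs = k" for xs x
  proof -
    have sum: "(\<Sum>i=1..k + 1. entry (xs @ [x]) i) = (\<Sum>i=1..k. entry xs i) + x"
      using len by (simp add: sum_entry_append flip: len)
    have "x \<ge> 2" if "Arf_sequence (xs @ [x])"
      using Arf_sequence_entry_ge_2[OF that, of "k + 1"] by (simp flip: len)
    \<comment> \<open>The bound by \<open>n\<close> comes for free: if \<open>s\<close> is the sum
      of \<open>xs\<close>, then \<open>s + x \<le> m \<le> n + 2\<close> and
      \<open>x \<ge> 2\<close> give \<open>s \<le> n\<close>.\<close>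
    then have "xs @ [x] \<in> ?L \<longleftrightarrow>
        Arf_sequence (xs @ [x]) \<and> (\<Sum>i=1..k. entry xs i) \<le> n \<and> (\<Sum>i=1..k. entry xs i) + x \<le> m"
      using assms(2) len unfolding Arf_sequences_le_def Arf_sequences_def mem_Collect_eq sum by auto
    moreover have "Arf_sequence (xs @ [x]) \<longleftrightarrow> Arf_sequence xs \<and> x \<in> Arf_S xs \<and> 0 < x"
      using Arf_sequence_snoc[of xs x] Arf_S_pos_iff[of xs x] len assms(1) by fastforce
    ultimately show ?thesis
      using len by (auto simp: Arf_sequences_le_def Arf_sequences_def)
  qed
  \<comment> \<open>Members of both sides split off a last entry after a prefix of length
    \<open>k\<close>, so \<open>snoc\<close> decides the equality of the sets.\<close>
  have "\<exists>xs x. zs = xs @ [x] \<and> length xs = k" if "zs \<in> ?L" for zs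
    using that by (auto simp: Arf_sequences_le_def Arf_sequences_def length_Suc_conv_rev)
  moreover have "length xs = k" if "xs \<in> Arf_sequences_le k n" for xs
    using that by (simp add: Arf_sequences_le_def Arf_sequences_def)
  ultimately show ?thesis
    using snoc by blast
qed

theorem corollary5:
  fixes b :: "nat \<Rightarrow> nat"
  assumes "\<And>i. 0 \<le> int (b (i + 1)) - int (b i) \<and> int (b (i + 1)) - int (b i) \<le> 2"
  shows "Arf_sequences_le 1 (int (b 1)) = {[x] | x. x \<in> {2..int (b 1)}} \<and>
    (\<forall>k\<ge>1. Arf_sequences_le (k + 1) (int (b (k + 1))) =
       {xs @ [x] | xs x. xs \<in> Arf_sequences_le k (int (b k)) \<and>
          x \<in> Arf_S xs \<inter> {0 <.. int (b (k + 1)) - (\<Sum>i=1..k. entry xs i)}})"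
proof (intro conjI allI impI)
  show "Arf_sequences_le 1 (int (b 1)) = {[x] | x. x \<in> {2..int (b 1)}}"
    by (rule Arf_sequences_le_1)
next
  fix k :: nat
  assume "k \<ge> 1"
  moreover have "int (b (k + 1)) \<le> int (b k) + 2"
    using assms[of k] by linarith
  ultimately show "Arf_sequences_le (k + 1) (int (b (k + 1))) =
       {xs @ [x] | xs x. xs \<in> Arf_sequences_le k (int (b k)) \<and>
          x \<in> Arf_S xs \<inter> {0 <.. int (b (k + 1)) - (\<Sum>i=1..k. entry xs i)}}"
    by (rule Arf_sequences_le_Suc)
qed

end
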